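(* The number of Dyck paths of semilength $n$ whose peak heights avoid the set $\{2r+3 \mid r \geq 0\}$ (that is, no peak has height in $\{3,5,7,\dots\}$) and whose up-runs all have length at most $2$ equals $1$ when $n = 0$, and equals $2^{n-1}$ when $n \geq 1$.
   Context: A Dyck path is a finite (possibly empty) word in the letters $U$ (standing for $+1$) and $D$ (standing for $-1$) whose partial sums are all nonnegative and whose total sum is $0$. A Dyck path of length $2n$ is said to have semilength $n$. The height of a path at position $k$ is the sum of its first $k$ terms. A peak at height $h$ is an occurrence of two consecutive steps $UD$ such that the height of the path right after the $U$ is $h$; by convention the empty path has a peak at height $0$. An up-run of length $\ell$ is a block of $\ell$ consecutive $U$'s that is neither preceded nor followed by a $U$ (a maximal block of $U$'s). *)

theory Defs
  imports Main
begin

datatype step = U | D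

fun step_value :: "step \<Rightarrow> int" where
  "step_value U = 1"
| "step_value D = -1"

definition height :: "step list \<Rightarrow> nat \<Rightarrow> int" where
  "height p k = sum_list (map step_value (take k p))"

definition dyck_path :: "step list \<Rightarrow> bool" where
  "dyck_path p \<longleftrightarrow> (\<forall>k\<le>length p. height p k \<ge> 0) \<and> height p (length p) = 0"

definition dyck_paths :: "nat \<Rightarrow> step list set" where
  "dyck_paths n = {p. dyck_path p \<and> length p = 2 * n}"

text \<open>By convention the empty path has a peak at height 0.\<close>

definition peak_heights :: "step list \<Rightarrow> int set" where
  "peak_heights p =
     (if p = [] then {0}
      else {height p (Suc k) | k. Suc k < length p \<and> p ! k = U \<and> p ! Suc k = D})"

definition up_run_lengths :: "step list \<Rightarrow> nat set" where
  "up_run_lengths p =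
     {l. l \<ge> 1 \<and> (\<exists>xs ys. p = xs @ replicate l U @ ys
        \<and> (xs = [] \<or> last xs \<noteq> U) \<and> (ys = [] \<or> hd ys \<noteq> U))}"

end

(* Such a path never exceeds height 2: before its first visit to height 3 it can only have climbed
   from height 1, and the next step gives either a peak at height 3 or a third consecutive U.
   Conversely, every Dyck path in the strip of heights 0..2 satisfies both conditions. Such a path
   is at height 1 after each odd number of steps, so when nonempty it is U, followed by n - 1
   blocks freely chosen from UD and DU, followed by D. *)

theory Submission
  imports Defs
begin

lemma height_0 [simp]: "height p 0 = 0"
  by (simp add: height_def)

lemma height_Cons_Suc [simp]: "height (x # p) (Suc k) = step_value x + height p k"
  by (simp add: height_def)

lemma height_Suc: "k < length p \<Longrightarrow> height p (Suc k) = height p k + step_value (p ! k)"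
  by (simp add: height_def take_Suc_conv_app_nth)

lemma height_append_replicate_U:
  "height (xs @ replicate l U @ ys) (length xs + l) = height (xs @ replicate l U @ ys) (length xs) + int l"
  by (simp add: height_def sum_list_replicate)

lemma strip_leading_U: "\<exists>a zs'. zs = replicate a U @ zs' \<and> (zs' = [] \<or> hd zs' \<noteq> U)"
proof (induction zs)
  case (Cons z zs)
  then obtain a zs' where zs: "zs = replicate a U @ zs'" "zs' = [] \<or> hd zs' \<noteq> U" by blast
  show ?case
  proof (cases z)
    case U
    then have "z # zs = replicate (Suc a) U @ zs'" using zs by simp
    then show ?thesis using zs(2) by blast
  next
    case D
    then have "z # zs = replicate 0 U @ (z # zs)" "hd (z # zs) \<noteq> U" by simp_all
    then show ?thesis by blast
  qed
qed simp

lemma strip_trailing_U: "\<exists>a zs'. zs = zs' @ replicate a U \<and> (zs' = [] \<or> last zs' \<noteq> U)"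
proof -
  obtain a zs' where "rev zs = replicate a U @ zs'" "zs' = [] \<or> hd zs' \<noteq> U"
    using strip_leading_U by blast
  then have "zs = rev zs' @ replicate a U" "rev zs' = [] \<or> last (rev zs') \<noteq> U"
    by (simp_all add: rev_swap last_rev)
  then show ?thesis by blast
qed

text \<open>\<open>up_run_lengths\<close> records only maximal blocks. Absorbing the
  \<open>U\<close>s at the end of \<open>xs\<close> and at the start of \<open>ys\<close> makes the
  given block maximal without shortening it.\<close>

lemma up_run_extends:
  assumes p: "p = xs @ replicate l U @ ys" and "l \<ge> 1"
  shows "\<exists>l'\<in>up_run_lengths p. l \<le> l'"
proof -
  obtain a xs' where xs: "xs = xs' @ replicate a U" "xs' = [] \<or> last xs' \<noteq> U"
    using strip_trailing_U by blast
  obtain b ys' where ys: "ys = replicate b U @ ys'" "ys' = [] \<or> hd ys' \<noteq> U"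
    using strip_leading_U by blast
  have "p = xs' @ replicate (a + l + b) U @ ys'"
    unfolding p xs ys by (simp add: replicate_add)
  moreover have "a + l + b \<ge> 1" using \<open>l \<ge> 1\<close> by simp
  ultimately have "a + l + b \<in> up_run_lengths p"
    using xs(2) ys(2) unfolding up_run_lengths_def by blast
  then show ?thesis by (rule bexI[rotated]) simp
qed

lemma three_consecutive_U:
  assumes "k + 2 < length p" "p ! k = U" "p ! (k + 1) = U" "p ! (k + 2) = U"
  shows "\<exists>l\<in>up_run_lengths p. 3 \<le> l"
proof (rule up_run_extends)
  have "drop k p = p ! k # p ! (k + 1) # p ! (k + 2) # drop (k + 3) p"
    using assms(1) Cons_nth_drop_Suc[of k p] Cons_nth_drop_Suc[of "k + 1" p]
      Cons_nth_drop_Suc[of "k + 2" p]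
    by (simp add: numeral_3_eq_3)
  then have "drop k p = replicate 3 U @ drop (k + 3) p"
    using assms(2-4) by (simp add: numeral_3_eq_3)
  then show "p = take k p @ replicate 3 U @ drop (k + 3) p"
    by (metis append_take_drop_id)
qed simp

lemma height_le_2:
  assumes p: "dyck_path p"
    and peaks: "peak_heights p \<inter> {2 * int r + 3 | r. r \<ge> 0} = {}"
    and runs: "\<forall>l\<in>up_run_lengths p. l \<le> 2"
    and "k \<le> length p"
  shows "height p k \<le> 2"
  using \<open>k \<le> length p\<close>
\<comment> \<open>Strong induction, because the bound is needed at both of the two preceding
  positions.\<close>
proof (induction k rule: less_induct)
  case (less k)
  show ?case
  proof (rule ccontr)
    assume high: "\<not> height p k \<le> 2"
    then obtain j where j: "k = Suc j" by (cases k) auto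
    have "height p j \<le> 2" using less j by simp
    \<comment> \<open>Steps change the height by one, so exceeding 2 for the first time means rising
      from 2 to exactly 3.\<close>
    then have pj: "p ! j = U" and hj: "height p j = 2" and hk: "height p k = 3"
      using high height_Suc[of j p] less.prems j by (cases "p ! j"; simp)+
    then obtain i where i: "j = Suc i" by (cases j) auto
    \<comment> \<open>A \<open>D\<close> at \<open>i\<close> would require height 3 there, so height
      2 at \<open>j\<close> was reached by a \<open>U\<close> as well.\<close>
    have "height p i \<le> 2" using less i j by simp
    then have pi: "p ! i = U"
      using height_Suc[of i p] hj less.prems i j by (cases "p ! i") auto
    \<comment> \<open>A further step exists, since the path ends at height 0 and not at 3.\<close>
    have k: "k < length p"
      using hk p less.prems unfolding dyck_path_def by (cases "k = length p") auto
    show False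
    proof (cases "p ! k")
      case U
      then show False
        using three_consecutive_U[of i p] k pi pj runs i j by force
    next
      case D
      then have "3 \<in> peak_heights p"
        using hk k pj j unfolding peak_heights_def by force
      moreover have "(3::int) \<in> {2 * int r + 3 | r. r \<ge> 0}"
        by (rule CollectI, rule exI[of _ 0]) simp
      ultimately show False using peaks by blast
    qed
  qed
qed

text \<open>Forbidden peaks start at height 3, and a run of \<open>l\<close> \<open>U\<close>s
  climbs by \<open>l\<close> inside a strip of width 2.\<close>

lemma height_le_2_imp_avoiding:
  assumes p: "dyck_path p" and le: "\<And>k. k \<le> length p \<Longrightarrow> height p k \<le> 2"
  shows "peak_heights p \<inter> {2 * int r + 3 | r. r \<ge> 0} = {}"
    and "\<forall>l\<in>up_run_lengths p. l \<le> 2"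
proof -
  have "h \<le> 2" if "h \<in> peak_heights p" for h
    using that le unfolding peak_heights_def by (auto split: if_splits)
  then show "peak_heights p \<inter> {2 * int r + 3 | r. r \<ge> 0} = {}"
    by fastforce
  show "\<forall>l\<in>up_run_lengths p. l \<le> 2"
  proof
    fix l assume "l \<in> up_run_lengths p"
    then obtain xs ys where eq: "p = xs @ replicate l U @ ys"
      unfolding up_run_lengths_def by blast
    then have "height p (length xs) \<ge> 0" "height p (length xs + l) \<le> 2"
      using p le unfolding dyck_path_def by simp_all
    then show "l \<le> 2"
      using height_append_replicate_U[of xs l ys] eq by simp
  qed
qed

text \<open>Paths that start at height \<open>h\<close>, end at height 0 and stay between heights 0 and 2. The bounds
  are not imposed on \<open>h\<close> itself.\<close>

fun strip_path :: "int \<Rightarrow> step list \<Rightarrow> bool" where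
  "strip_path h [] \<longleftrightarrow> h = 0"
| "strip_path h (x # p) \<longleftrightarrow>
     0 \<le> h + step_value x \<and> h + step_value x \<le> 2 \<and> strip_path (h + step_value x) p"

text \<open>The right-hand side at \<open>k = 0\<close> constrains \<open>h\<close>, which
  \<open>strip_path\<close> does not check; hence the assumptions.\<close>

lemma strip_path_iff:
  assumes "0 \<le> h" "h \<le> 2"
  shows "strip_path h p \<longleftrightarrow>
    (\<forall>k\<le>length p. 0 \<le> h + height p k \<and> h + height p k \<le> 2) \<and> h + height p (length p) = 0"
  using assms
proof (induction p arbitrary: h)
  case (Cons x p)
  \<comment> \<open>Splitting off position 0 leaves the shifted condition, which is the induction
    hypothesis at \<open>h + step_value x\<close>.\<close>
  have all: "(\<forall>k\<le>Suc n. P k) \<longleftrightarrow> P 0 \<and> (\<forall>k\<le>n. P (Suc k))" for P :: "nat \<Rightarrow> bool" and n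
    by (metis Suc_le_mono not0_implies_Suc zero_le)
  show ?case
  proof (cases "0 \<le> h + step_value x \<and> h + step_value x \<le> 2")
    case True
    then show ?thesis
      using Cons by (simp add: all add.assoc)
  next
    case False
    then show ?thesis
      by (force simp: all)
  qed
qed auto

lemma dyck_path_avoiding_iff_strip_path:
  "dyck_path p \<and> peak_heights p \<inter> {2 * int r + 3 | r. r \<ge> 0} = {} \<and> (\<forall>l\<in>up_run_lengths p. l \<le> 2)
    \<longleftrightarrow> strip_path 0 p" (is "?L \<longleftrightarrow> ?R")
proof
  assume L: ?L
  then have "\<forall>k\<le>length p. height p k \<le> 2" using height_le_2 by blast
  with L show ?R by (simp add: strip_path_iff dyck_path_def)
next
  assume ?R
  then have "dyck_path p" "\<And>k. k \<le> length p \<Longrightarrow> height p k \<le> 2"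
    by (simp_all add: strip_path_iff dyck_path_def)
  then show ?L using height_le_2_imp_avoiding by blast
qed

text \<open>The first step leads to a boundary of the strip, 0 or 2, where only the step back to 1
  is allowed.\<close>

lemma strip_path_1_Cons_Cons:
  "strip_path 1 (x # y # p) \<longleftrightarrow> (x = U \<and> y = D \<or> x = D \<and> y = U) \<and> strip_path 1 p"
  by (cases x; cases y) simp_all

text \<open>Each leading pair doubles the count, and the odd length leaves a final \<open>D\<close>.
  Finiteness is carried along for the cardinality of the union.\<close>

lemma card_strip_path_1:
  "finite {p. length p = Suc (2 * m) \<and> strip_path 1 p} \<and>
   card {p. length p = Suc (2 * m) \<and> strip_path 1 p} = 2 ^ m"
proof (induction m)
  case 0
  have "strip_path 1 [x] \<longleftrightarrow> x = D" for x by (cases x) simp_all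
  then have "{p. length p = Suc (2 * 0) \<and> strip_path 1 p} = {[D]}"
    by (auto simp: length_Suc_conv simp del: strip_path.simps)
  then show ?case by simp
next
  case (Suc m)
  let ?A = "{p. length p = Suc (2 * m) \<and> strip_path 1 p}"
  have "{p. length p = Suc (2 * Suc m) \<and> strip_path 1 p}
      = (\<lambda>p. U # D # p) ` ?A \<union> (\<lambda>p. D # U # p) ` ?A" (is "?S = ?T")
  proof (rule set_eqI)
    fix p
    show "p \<in> ?S \<longleftrightarrow> p \<in> ?T"
    proof (cases "\<exists>x y q. p = x # y # q")
      case True
      then show ?thesis
        by (auto simp: strip_path_1_Cons_Cons simp del: strip_path.simps)
    next
      \<comment> \<open>Lists with fewer than two letters are too short for either side.\<close>
      case False
      then show ?thesis
        by (auto simp: length_Suc_conv simp del: strip_path.simps)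
    qed
  qed
  \<comment> \<open>The two images are disjoint because their first letters differ.\<close>
  moreover have "card ((\<lambda>p. U # D # p) ` ?A \<union> (\<lambda>p. D # U # p) ` ?A) = card ?A + card ?A"
    using Suc by (subst card_Un_disjoint) (auto simp: card_image inj_on_def)
  ultimately show ?case using Suc by simp
qed

theorem proposition3:
  fixes n :: nat
  shows "card {p \<in> dyck_paths n.
            peak_heights p \<inter> {2 * int r + 3 | r. r \<ge> 0} = {}
            \<and> (\<forall>l \<in> up_run_lengths p. l \<le> 2)}
         = (if n = 0 then 1 else 2 ^ (n - 1))"
proof -
  have eq: "{p \<in> dyck_paths n. peak_heights p \<inter> {2 * int r + 3 | r. r \<ge> 0} = {}
            \<and> (\<forall>l \<in> up_run_lengths p. l \<le> 2)} = {p. length p = 2 * n \<and> strip_path 0 p}"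
    unfolding dyck_paths_def mem_Collect_eq dyck_path_avoiding_iff_strip_path[symmetric]
    by (rule Collect_cong) (simp only: conj_ac)
  show ?thesis
  proof (cases n)
    case 0
    have "{p. length p = 2 * 0 \<and> strip_path 0 p} = {[]}" by auto
    with 0 show ?thesis unfolding eq by simp
  next
    case (Suc m)
    have step: "strip_path 0 (x # p) \<longleftrightarrow> x = U \<and> strip_path 1 p" for x p
      by (cases x) simp_all
    \<comment> \<open>Removing the forced initial \<open>U\<close> leaves length
      \<open>2 * m + 1\<close> with \<open>m = n - 1\<close>, which is the exponent claimed.\<close>
    have "p \<in> {p. length p = 2 * n \<and> strip_path 0 p}
        \<longleftrightarrow> p \<in> (#) U ` {p. length p = Suc (2 * m) \<and> strip_path 1 p}" for p
      using Suc by (cases p) (auto simp: step simp del: strip_path.simps)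
    then have "{p. length p = 2 * n \<and> strip_path 0 p}
        = (#) U ` {p. length p = Suc (2 * m) \<and> strip_path 1 p}"
      by blast
    then show ?thesis
      unfolding eq using Suc conjunct2[OF card_strip_path_1[of m]] by (simp add: card_image)
  qed
qed

end
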